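(* Let $G=(V,E)$ be a quantum network, let $S$ be a finite set of source-destination pairs $(s,d)$ of nodes of $G$, let $L$ be a given finite set of candidate super-links whose associated paths in $G$ are pairwise disjoint, and let $C$ be a cost budget. Let $\psi(S,\cdot)$ be the aggregate-latency function and $Cost(\cdot)$ the additive super-link cost, as defined in the context. For $L'\subseteq L$ define the benefit of $L'$ to be $\psi(S,\emptyset)-\psi(S,L')$. Consider the Greedy algorithm: start with $L'=\emptyset$; while $Cost(L')<C$ and $L\setminus L'\neq\emptyset$, choose $l\in L\setminus L'$ maximizing $$\frac{\psi(S,L')-\psi(S,L'\cup\{l\})}{Cost(l)}$$ and replace $L'$ by $L'\cup\{l\}$; when the loop ends, return $L'$. Then the returned set $L'$ has benefit at least $63\%$ of the benefit of an optimal solution, i.e. $$\psi(S,\emptyset)-\psi(S,L')\;\ge\;0.63\cdot\max\{\psi(S,\emptyset)-\psi(S,L^* )\;:\;L^*\subseteq L,\ Cost(L^* )\le C\}.$$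
   Context: A quantum network is a finite graph $G=(V,E)$ of nodes and links. An entangled pair (EP) over two nodes can be generated along a path between them by a "swapping tree" (a binary tree of entanglement-swapping operations over the links of the path), with a certain expected generation latency. A super-link (SL) is a pair $l=(A,B)$ of nodes of $G$ together with an associated path between $A$ and $B$ (and a swapping tree over it), over which EPs are continuously generated in advance. Super-links are disjoint if their associated paths share no node and no link. It is assumed that sufficiently many EPs are available at each selected SL when a request arrives, and that at most one SL is used to generate an EP for any $(s,d)$. Latencies. For nodes $x,y$, let $T_{x,y}\ge 0$ denote the (given) expected latency of generating an EP over $(x,y)$ without any super-link. Let $p_b\in(0,1]$ be the success probability and $t_b\ge 0$ the operation latency of the entanglement-swapping operation, and $t_c\ge0$ the classical transmission latency. The expected latency of generating an EP over $(s,d)$ using the super-link $l=(A,B)$ is $$T((s,d),l)=\min\Big\{\tfrac{1}{p_b}\big(\tfrac32\max\big(\tfrac{T_{s,A}+t_b+t_c}{p_b},\,T_{B,d}\big)+t_b+t_c\big),\ \tfrac{1}{p_b}\big(\tfrac32\max\big(T_{s,A},\,\tfrac{T_{B,d}+t_b+t_c}{p_b}\big)+t_b+t_c\big)\Big\}.$$ In particular, $T((s,d),l)$ does not depend on which other super-links are selected. Aggregate latency. For a set $L'$ of super-links, $\psi(S,L')=\sum_{(s,d)\in S}\min\big(\{T_{s,d}\}\cup\{T((s,d),l): l\in L'\}\big)$; in particular $\psi(S,\emptyset)=\sum_{(s,d)\in S}T_{s,d}$. Cost. Each super-link $l$ has a given cost $Cost(l)>0$ (the number of link-level failures of the underlying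 operations incurred in generating one EP over $l$ via its swapping tree; the particular cost model plays no role), and $Cost(L')=\sum_{l\in L'}Cost(l)$. The optimization problem (called GD-SLS): given $G$, $S$, the set $L$ of candidate super-links with pairwise disjoint associated paths, and the budget $C$, select a subset $L'\subseteq L$ with $Cost(L')\le C$ minimizing $\psi(S,L')$ (equivalently, maximizing the benefit). The loop condition of the Greedy algorithm is as stated in the claim, so the last super-link added may make $Cost(L')$ exceed $C$; the optimal solution is taken over sets of cost at most $C$. *)

theory Defs
  imports Complex_Main "Graph_Theory.Arc_Walk"
begin

section \<open>Super-links\<close>

text \<open>
  The graph of a quantum network is a symmetric digraph, so an undirected link consists of two
  opposite arcs. A path is a list of arcs. The leaves of a swapping tree are the links
  (traversed arcs) of its path, from left to right; an inner node is an entanglement-swapping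
  operation.
\<close>

datatype 'b swap_tree = Link_EP 'b | Swap "'b swap_tree" "'b swap_tree"

fun leaves :: "'b swap_tree \<Rightarrow> 'b list" where
  "leaves (Link_EP e) = [e]"
| "leaves (Swap t u) = leaves t @ leaves u"

datatype ('a, 'b) super_link =
  Super_Link (sl_src: 'a) (sl_dst: 'a) (sl_path: "'b list") (sl_tree: "'b swap_tree")

definition is_super_link :: "('a, 'b) pre_digraph \<Rightarrow> ('a, 'b) super_link \<Rightarrow> bool" where
  "is_super_link G l \<longleftrightarrow>
     pre_digraph.apath G (sl_src l) (sl_path l) (sl_dst l) \<and> leaves (sl_tree l) = sl_path l"

definition sl_nodes :: "('a, 'b) pre_digraph \<Rightarrow> ('a, 'b) super_link \<Rightarrow> 'a set" where
  "sl_nodes G l = set (pre_digraph.awalk_verts G (sl_src l) (sl_path l))"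

text \<open>Links are compared as undirected edges, i.e. up to the direction of traversal.\<close>

definition sl_links :: "('a, 'b) pre_digraph \<Rightarrow> ('a, 'b) super_link \<Rightarrow> 'a set set" where
  "sl_links G l = (\<lambda>e. {tail G e, head G e}) ` set (sl_path l)"

definition disjoint_super_links ::
    "('a, 'b) pre_digraph \<Rightarrow> ('a, 'b) super_link \<Rightarrow> ('a, 'b) super_link \<Rightarrow> bool" where
  "disjoint_super_links G l l' \<longleftrightarrow>
     sl_nodes G l \<inter> sl_nodes G l' = {} \<and> sl_links G l \<inter> sl_links G l' = {}"


section \<open>Latency, benefit and cost\<close>

text \<open>
  \<open>T x y\<close> is the expected latency of an entangled pair over \<open>(x, y)\<close> without any super-link.
  The two arguments of the outer minimum are the two orders in which the pairs over
  \<open>(s, A)\<close>, \<open>(A, B)\<close> and \<open>(B, d)\<close> can be swapped.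
\<close>

definition sl_latency ::
    "('a \<Rightarrow> 'a \<Rightarrow> real) \<Rightarrow> real \<Rightarrow> real \<Rightarrow> real \<Rightarrow> 'a \<times> 'a \<Rightarrow> ('a, 'b) super_link \<Rightarrow> real" where
  "sl_latency T p_b t_b t_c = (\<lambda>(s, d) l.
     let A = sl_src l; B = sl_dst l in
       min (1 / p_b * (3 / 2 * max ((T s A + t_b + t_c) / p_b) (T B d) + t_b + t_c))
           (1 / p_b * (3 / 2 * max (T s A) ((T B d + t_b + t_c) / p_b) + t_b + t_c)))"

definition aggregate_latency ::
    "('a \<Rightarrow> 'a \<Rightarrow> real) \<Rightarrow> real \<Rightarrow> real \<Rightarrow> real \<Rightarrow> ('a \<times> 'a) set \<Rightarrow> ('a, 'b) super_link set \<Rightarrow> real" where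
  "aggregate_latency T p_b t_b t_c S L' =
     (\<Sum>(s, d)\<in>S. Min ({T s d} \<union> {sl_latency T p_b t_b t_c (s, d) l | l. l \<in> L'}))"

definition benefit :: "('l set \<Rightarrow> real) \<Rightarrow> 'l set \<Rightarrow> real" where
  "benefit \<psi> L' = \<psi> {} - \<psi> L'"

definition total_cost :: "('l \<Rightarrow> real) \<Rightarrow> 'l set \<Rightarrow> real" where
  "total_cost cost L' = (\<Sum>l\<in>L'. cost l)"


section \<open>The greedy algorithm\<close>

text \<open>
  \<open>greedy \<psi> cost L C L' R\<close>: the loop, entered with current set \<open>L'\<close>, can return \<open>R\<close>.
  Ties are broken arbitrarily, so there may be several such \<open>R\<close>.
\<close>

inductive greedy ::
    "('l set \<Rightarrow> real) \<Rightarrow> ('l \<Rightarrow> real) \<Rightarrow> 'l set \<Rightarrow> real \<Rightarrow> 'l set \<Rightarrow> 'l set \<Rightarrow> bool"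
  for \<psi> cost L C where
  stop: "\<not> (total_cost cost L' < C \<and> L - L' \<noteq> {}) \<Longrightarrow> greedy \<psi> cost L C L' L'"
| step: "total_cost cost L' < C \<Longrightarrow> L - L' \<noteq> {} \<Longrightarrow>
    is_arg_max (\<lambda>l. (\<psi> L' - \<psi> (L' \<union> {l})) / cost l) (\<lambda>l. l \<in> L - L') l \<Longrightarrow>
    greedy \<psi> cost L C (L' \<union> {l}) R \<Longrightarrow> greedy \<psi> cost L C L' R"

lemma greedy_terminates:
  assumes "finite L"
  shows "\<exists>R. greedy \<psi> cost L C L' R"
proof (induction "card (L - L')" arbitrary: L' rule: less_induct)
  case less
  show ?case
  proof (cases "total_cost cost L' < C \<and> L - L' \<noteq> {}")
    case True
    let ?f = "\<lambda>l. (\<psi> L' - \<psi> (L' \<union> {l})) / cost l"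
    have fin: "finite (L - L')" using assms by simp
    then have "Max (?f ` (L - L')) \<in> ?f ` (L - L')" using True by (intro Max_in) auto
    then obtain l where l: "l \<in> L - L'" "?f l = Max (?f ` (L - L'))" by force
    then have m: "is_arg_max ?f (\<lambda>l. l \<in> L - L') l"
      using fin by (simp add: is_arg_max_linorder)
    have "card (L - (L' \<union> {l})) < card (L - L')"
      using l fin by (intro psubset_card_mono) auto
    then obtain R where "greedy \<psi> cost L C (L' \<union> {l}) R" using less by blast
    then show ?thesis using greedy.step[OF _ _ m] True by blast
  qed (blast intro: greedy.stop)
qed

end

theory Submission
  imports Defs
begin

text \<open>
  The benefit is a monotone submodular function of the selected set, because each summand of the
  aggregate latency is a minimum over that set. By submodularity, the gap between a feasible set
  and the current greedy set is at most \<open>C\<close> times the best gain per cost, so adding a super-link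
  of cost \<open>c\<close> shrinks the gap by a factor of at most \<open>1 - c / C \<le> exp (- c / C)\<close>. Once the cost
  reaches \<open>C\<close>, at most \<open>1 / e < 0.37\<close> of the initial gap is left.
\<close>

locale supermodular_cost =
  fixes \<psi> :: "'l set \<Rightarrow> real" and cost :: "'l \<Rightarrow> real" and L :: "'l set"
  assumes finite_L: "finite L"
    and cost_pos: "l \<in> L \<Longrightarrow> 0 < cost l"
    and antimono: "X \<subseteq> Y \<Longrightarrow> Y \<subseteq> L \<Longrightarrow> \<psi> Y \<le> \<psi> X"
    and diminishing: "X \<subseteq> Y \<Longrightarrow> Y \<subseteq> L \<Longrightarrow> l \<in> L \<Longrightarrow>
      \<psi> Y - \<psi> (insert l Y) \<le> \<psi> X - \<psi> (insert l X)"
begin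

text \<open>Telescoping: the elements of \<open>A\<close> are added to \<open>X\<close> one at a
  time, and by \<open>diminishing\<close> each gains at most what it would gain when added to
  \<open>X\<close> alone.\<close>

lemma union_gain_le_sum:
  assumes "X \<subseteq> L" and "A \<subseteq> L"
  shows "\<psi> X - \<psi> (X \<union> A) \<le> (\<Sum>a\<in>A. \<psi> X - \<psi> (insert a X))"
proof -
  have "finite A" using assms(2) finite_L by (rule finite_subset)
  then show ?thesis using assms(2)
  proof (induction A)
    case (insert a A)
    then have "\<psi> (X \<union> A) - \<psi> (insert a (X \<union> A)) \<le> \<psi> X - \<psi> (insert a X)"
      using assms(1) by (intro diminishing) auto
    with insert show ?case by simp
  qed simp
qed

lemma gap_le_ratio_times_cost:
  assumes "X \<subseteq> L" and "A \<subseteq> L" and "0 \<le> r"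
    and r: "\<And>a. a \<in> L - X \<Longrightarrow> (\<psi> X - \<psi> (insert a X)) / cost a \<le> r"
  shows "\<psi> X - \<psi> A \<le> r * total_cost cost A"
proof -
  have "\<psi> X - \<psi> A \<le> \<psi> X - \<psi> (X \<union> A)"
    using antimono[of A "X \<union> A"] assms by simp
  also have "\<dots> \<le> (\<Sum>a\<in>A. \<psi> X - \<psi> (insert a X))"
    by (rule union_gain_le_sum) fact+
  also have "\<dots> \<le> (\<Sum>a\<in>A. r * cost a)"
  proof (rule sum_mono)
    fix a assume "a \<in> A"
    with assms(2) have a: "a \<in> L" and "0 < cost a" using cost_pos by auto
    then show "\<psi> X - \<psi> (insert a X) \<le> r * cost a"
      \<comment> \<open>The bound \<open>r\<close> only speaks about elements outside
        \<open>X\<close>; an element of \<open>X\<close> gains 0, which is where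
        \<open>0 \<le> r\<close> enters.\<close>
      using r[of a] \<open>0 \<le> r\<close> by (cases "a \<in> X") (simp_all add: insert_absorb divide_le_eq)
  qed
  finally show ?thesis by (simp add: total_cost_def sum_distrib_left)
qed

text \<open>This is the loop invariant. \<open>A\<close> is any set within the budget, and
  \<open>D\<close> stands for the initial gap to \<open>A\<close>, kept fixed through the
  loop.\<close>

lemma greedy_step_gap:
  assumes "0 < C" and X: "X \<subseteq> L" and A: "A \<subseteq> L" "total_cost cost A \<le> C"
    and l: "is_arg_max (\<lambda>l. (\<psi> X - \<psi> (X \<union> {l})) / cost l) (\<lambda>l. l \<in> L - X) l"
    and D: "0 \<le> D" "\<psi> X - \<psi> A \<le> exp (- total_cost cost X / C) * D"
  shows "\<psi> (X \<union> {l}) - \<psi> A \<le> exp (- total_cost cost (X \<union> {l}) / C) * D"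
proof -
  define r where "r = (\<psi> X - \<psi> (insert l X)) / cost l"
  have lL: "l \<in> L" "l \<notin> X" and r: "a \<in> L - X \<Longrightarrow> (\<psi> X - \<psi> (insert a X)) / cost a \<le> r" for a
    using l by (auto simp: is_arg_max_linorder r_def)
  have c: "0 < cost l" using lL cost_pos by simp
  have "\<psi> (insert l X) \<le> \<psi> X" using lL X by (intro antimono) auto
  then have r0: "0 \<le> r" using c by (simp add: r_def)
  have gain: "\<psi> (insert l X) = \<psi> X - r * cost l" using c by (simp add: r_def)
  have cost: "total_cost cost (insert l X) = cost l + total_cost cost X"
    using lL finite_subset[OF X finite_L] by (simp add: total_cost_def)
  have "\<psi> (insert l X) - \<psi> A \<le> exp (- total_cost cost (insert l X) / C) * D"
  \<comment> \<open>The gap is later multiplied into an inequality, so a nonpositive gap is treated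
    apart; it stays nonpositive because \<psi> is antitone.\<close>
  proof (cases "\<psi> X \<le> \<psi> A")
    case True
    then have "\<psi> (insert l X) - \<psi> A \<le> 0" using \<open>\<psi> (insert l X) \<le> \<psi> X\<close> by simp
    also have "0 \<le> exp (- total_cost cost (insert l X) / C) * D" using D by simp
    finally show ?thesis .
  next
    case False
    have "\<psi> X - \<psi> A \<le> r * total_cost cost A"
      using gap_le_ratio_times_cost[OF X A(1) r0] r by blast
    also have "\<dots> \<le> r * C" using A r0 by (simp add: mult_left_mono)
    \<comment> \<open>The scaling turns the right side into \<open>r * cost l\<close>, the exact
      gain of \<open>l\<close>: the step closes at least a fraction \<open>cost l / C\<close> of the
      gap.\<close>
    finally have "(\<psi> X - \<psi> A) * (cost l / C) \<le> r * C * (cost l / C)"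
      using c \<open>0 < C\<close> by (intro mult_right_mono) auto
    then have "(\<psi> X - \<psi> A) * (cost l / C) \<le> r * cost l" using \<open>0 < C\<close> by simp
    then have "\<psi> (insert l X) - \<psi> A \<le> (1 + - (cost l / C)) * (\<psi> X - \<psi> A)"
      by (simp add: gain algebra_simps)
    \<comment> \<open>The bound \<open>1 + x \<le> exp x\<close> holds for every real
      \<open>x\<close>, so a super-link with \<open>cost l > C\<close> is covered too.\<close>
    also have "\<dots> \<le> exp (- (cost l / C)) * (\<psi> X - \<psi> A)"
      using False by (intro mult_right_mono exp_ge_add_one_self) auto
    also have "\<dots> \<le> exp (- (cost l / C)) * (exp (- total_cost cost X / C) * D)"
      using D by (intro mult_left_mono) auto
    also have "\<dots> = exp (- total_cost cost (insert l X) / C) * D"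
      by (simp add: cost add_divide_distrib diff_divide_distrib flip: exp_add)
    finally show ?thesis .
  qed
  then show ?thesis by simp
qed

text \<open>The invariant is carried to the exit of the loop. There either the cost has reached
  \<open>C\<close>, so the exponent is at most -1, or all of \<open>L\<close> is selected and no
  subset of \<open>L\<close> does better.\<close>

lemma greedy_gap:
  assumes "greedy \<psi> cost L C X R" and "X \<subseteq> L" and "0 < C"
    and "A \<subseteq> L" and "total_cost cost A \<le> C"
    and "0 \<le> D" and "\<psi> X - \<psi> A \<le> exp (- total_cost cost X / C) * D"
  shows "\<psi> R - \<psi> A \<le> exp (- 1) * D"
  using assms
proof (induction rule: greedy.induct)
  case (stop X)
  then consider "C \<le> total_cost cost X" | "X = L" by fastforce
  then show ?case
  proof cases
    case 1
    then have "exp (- total_cost cost X / C) * D \<le> exp (- 1) * D"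
      using stop.prems by (intro mult_right_mono) auto
    with stop.prems show ?thesis by linarith
  next
    case 2
    then have "\<psi> X - \<psi> A \<le> 0" using antimono[of A L] stop.prems by simp
    also have "0 \<le> exp (- 1) * D" using stop.prems by simp
    finally show ?thesis .
  qed
next
  case (step X l R)
  have "l \<in> L" using step.hyps(3) by (auto simp: is_arg_max_def)
  then show ?case
    using step.prems greedy_step_gap[OF _ _ _ _ step.hyps(3)] by (intro step.IH) auto
qed

lemma exp_minus_one_le: "exp (- 1) \<le> (0.37 :: real)"
proof -
  \<comment> \<open>The exponent 100 is large enough: 1.01^100 is about 2.7048, just above 1 / 0.37,
    about 2.7027.\<close>
  have "(1 + 1 / real 100) ^ 100 \<le> exp (1 :: real)"
    by (rule exp_ge_one_plus_x_over_n_power_n) auto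
  moreover have "1 / 0.37 \<le> (1 + 1 / real 100) ^ 100" by (simp add: power_divide)
  ultimately have "1 / 0.37 \<le> exp (1 :: real)" by linarith
  then show ?thesis by (simp add: exp_minus field_simps)
qed

theorem greedy_benefit:
  assumes greedy: "greedy \<psi> cost L C {} R" and "0 \<le> C"
    and A: "A \<subseteq> L" "total_cost cost A \<le> C"
  shows "0.63 * benefit \<psi> A \<le> benefit \<psi> R"
proof (cases "0 < C")
  case True
  have D: "0 \<le> \<psi> {} - \<psi> A" using antimono[of "{}" A] A by simp
  have "\<psi> R - \<psi> A \<le> exp (- 1) * (\<psi> {} - \<psi> A)"
    \<comment> \<open>The invariant holds initially with equality, since the empty set costs 0 and
      \<open>exp 0 = 1\<close>.\<close>
    by (rule greedy_gap[OF greedy _ True A D]) (auto simp: total_cost_def)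
  also have "\<dots> \<le> 0.37 * (\<psi> {} - \<psi> A)"
    using D exp_minus_one_le by (intro mult_right_mono)
  finally show ?thesis by (simp add: benefit_def field_simps)
next
  case False
  \<comment> \<open>The exponent divides by \<open>C\<close>, so a zero budget is separate: the loop
    stops at once, and positive costs leave only the empty set within the budget.\<close>
  then have C: "C = 0" using \<open>0 \<le> C\<close> by simp
  have "R = {}" using greedy by cases (auto simp: C total_cost_def)
  moreover have "A = {}"
  proof (rule ccontr)
    assume "A \<noteq> {}"
    then have "0 < total_cost cost A"
      unfolding total_cost_def using A finite_L cost_pos
      by (intro sum_pos) (auto intro: finite_subset)
    with A C show False by simp
  qed
  ultimately show ?thesis by (simp add: benefit_def)
qed

end

text \<open>Inserting \<open>a\<close> lowers a minimum \<open>m\<close> by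
  \<open>max 0 (m - a)\<close>, which is monotone in \<open>m\<close>, and the larger set has the
  smaller minimum.\<close>

lemma Min_insert_diminishing:
  fixes A B :: "real set"
  assumes "A \<subseteq> B" and "finite B" and "A \<noteq> {}"
  shows "Min B - Min (insert a B) \<le> Min A - Min (insert a A)"
proof -
  have "Min B \<le> Min A" using assms by (intro Min_antimono)
  then have "Min B - min a (Min B) \<le> Min A - min a (Min A)" by linarith
  moreover have "finite A" "B \<noteq> {}" using assms finite_subset by auto
  ultimately show ?thesis using assms by (simp only: Min_insert not_False_eq_True)
qed

lemma aggregate_latency_eq:
  "aggregate_latency T p_b t_b t_c S X =
     (\<Sum>(s, d)\<in>S. Min (insert (T s d) (sl_latency T p_b t_b t_c (s, d) ` X)))"
  by (simp add: aggregate_latency_def image_def Setcompr_eq_image Bex_def conj_commute)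

lemma aggregate_latency_antimono:
  assumes "X \<subseteq> Y" and "finite Y"
  shows "aggregate_latency T p_b t_b t_c S Y \<le> aggregate_latency T p_b t_b t_c S X"
  unfolding aggregate_latency_eq
  using assms by (intro sum_mono) (auto intro!: Min_antimono)

lemma aggregate_latency_diminishing:
  assumes "X \<subseteq> Y" and "finite Y"
  shows "aggregate_latency T p_b t_b t_c S Y - aggregate_latency T p_b t_b t_c S (insert l Y)
    \<le> aggregate_latency T p_b t_b t_c S X - aggregate_latency T p_b t_b t_c S (insert l X)"
proof -
  have "Min (insert (T s d) (f ` Y)) - Min (insert (T s d) (f ` insert l Y))
      \<le> Min (insert (T s d) (f ` X)) - Min (insert (T s d) (f ` insert l X))"
    for s d and f :: "('a, 'b) super_link \<Rightarrow> real"
    \<comment> \<open>The new latency \<open>f l\<close> is moved outermost; the sets below it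
      contain \<open>T s d\<close> and hence are nonempty.\<close>
    unfolding image_insert insert_commute[of "T s d" "f l"]
    using assms by (intro Min_insert_diminishing insert_mono image_mono) auto
  then show ?thesis
    unfolding aggregate_latency_eq
    by (simp only: sum_subtractf[symmetric] case_prod_beta) (intro sum_mono, blast)
qed

theorem theorem1:
  fixes G :: "('a, 'b) pre_digraph"
    and S :: "('a \<times> 'a) set"
    and L L' :: "('a, 'b) super_link set"
    and T :: "'a \<Rightarrow> 'a \<Rightarrow> real"
    and p_b t_b t_c C :: real
    and cost :: "('a, 'b) super_link \<Rightarrow> real"
    and \<psi> :: "('a, 'b) super_link set \<Rightarrow> real"
  assumes "graph G"
    and "finite S" and "S \<subseteq> verts G \<times> verts G"
    and "finite L" and "\<And>l. l \<in> L \<Longrightarrow> is_super_link G l"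
    and "\<And>l l'. l \<in> L \<Longrightarrow> l' \<in> L \<Longrightarrow> l \<noteq> l' \<Longrightarrow> disjoint_super_links G l l'"
    and "\<And>x y. x \<in> verts G \<Longrightarrow> y \<in> verts G \<Longrightarrow> 0 \<le> T x y"
    and "0 < p_b" and "p_b \<le> 1" and "0 \<le> t_b" and "0 \<le> t_c"
    and "\<And>l. l \<in> L \<Longrightarrow> 0 < cost l"
    and "0 \<le> C"
    and "\<psi> = aggregate_latency T p_b t_b t_c S"
    and "greedy \<psi> cost L C {} L'"
  shows "benefit \<psi> L' \<ge>
    0.63 * Max {benefit \<psi> Lopt | Lopt. Lopt \<subseteq> L \<and> total_cost cost Lopt \<le> C}"
proof -
  interpret supermodular_cost \<psi> cost L
    using assms(4,12) finite_subset[OF _ assms(4)]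
    by unfold_locales
      (auto simp: assms(14) intro: aggregate_latency_antimono aggregate_latency_diminishing)
  let ?B = "{benefit \<psi> A | A. A \<subseteq> L \<and> total_cost cost A \<le> C}"
  have "?B \<subseteq> benefit \<psi> ` Pow L" by auto
  then have "finite ?B" using assms(4) by (simp add: finite_subset)
  \<comment> \<open>The empty set fits any nonnegative budget, so the maximum is over a nonempty set
    and is attained.\<close>
  moreover have "benefit \<psi> {} \<in> ?B" using assms(13) by (auto simp: total_cost_def)
  ultimately have "Max ?B \<in> ?B" by (intro Max_in) auto
  then obtain A where "A \<subseteq> L" "total_cost cost A \<le> C" "Max ?B = benefit \<psi> A" by auto
  with greedy_benefit[OF assms(15,13)] show ?thesis by simp
qed

end
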